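(* (Unidentifiability.) Let the eviction mechanism be deterministic and value-blind, meaning that the retained set $\mathcal{S}$ is a function of the keys, scores, and query history only. Then for every $\mathcal{F}_t$-measurable estimator $\widehat{E}$ and every $M > 0$ there exist two cache configurations that generate identical online information $\mathcal{F}_t$ and whose true errors $\|\hat{y}_t - y_t\|$ differ by more than $M$. Consequently no $\mathcal{F}_t$-measurable estimator of the eviction error is consistent, uniformly over cache configurations.
   Context: Fix one attention head at decode step $t$. The cache is $\mathcal{C} = \{(k_i, v_i)\}_{i=1}^{n}$, consisting of keys $k_i$ and values $v_i$ (write $i \in \mathcal{C}$ for $i \in \{1,\dots,n\}$); the query is $q_t$; the scores are $s_i = q_t^\top k_i/\sqrt{d}$, where $d$ is the dimension of the keys and query; the weights are $a_i = e^{s_i}$; and the full-cache head output is the self-normalized mean $$y_t = \frac{\sum_{i \in \mathcal{C}} a_i v_i}{\sum_{i \in \mathcal{C}} a_i}.$$ An eviction mechanism maps the prefill state to a retained set $\mathcal{S} \subseteq \mathcal{C}$; tokens outside $\mathcal{S}$ are deleted permanently. The online information $\mathcal{F}_t$ available to the serving system at step $t$ is the retained key--value pairs, the design (any sampling probabilities the mechanism used), the query history, and every quantity computed from these. Evicted values are not $\mathcal{F}_t$-measurable. An estimator is $\mathcal{F}_t$-measurable if it is computed from $\mathcal{F}_t$. The estimation target, called the true error or eviction error, is $\|\hat{y}_t - y_t\|$, where $\hat{y}_t$ is whatever output the system computes from $\mathcal{S}$.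
   Formalization: The eviction mechanism is additionally assumed to delete at least one token for at least one configuration; if the retained set is always the whole cache, the online information determines the true error and the claim is false. *)

theory Defs
  imports "HOL-Analysis.Analysis" "HOL-Probability.Probability_Mass_Function"
begin

text \<open>
  One attention head at one decode step. Keys and queries live in \<open>real ^ 'd\<close>, values in
  \<open>real ^ 'v\<close>. The cache is a list, so tokens are numbered from 0; the query history is
  \<open>q_1, ..., q_t\<close> in this order, the current query being its last entry.
\<close>

record ('d, 'v) config =
  cache :: "((real ^ 'd) \<times> (real ^ 'v)) list"
  queries :: "(real ^ 'd) list"

definition configs :: "nat \<Rightarrow> nat \<Rightarrow> ('d::finite, 'v::finite) config set" where
  "configs t n = {c. length (queries c) = t \<and> queries c \<noteq> [] \<and> length (cache c) = n}"

definition tokens :: "('d::finite, 'v::finite) config \<Rightarrow> nat set" where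
  "tokens c = {..<length (cache c)}"

definition keys :: "('d::finite, 'v::finite) config \<Rightarrow> (real ^ 'd) list" where
  "keys c = map fst (cache c)"

definition score :: "('d::finite, 'v::finite) config \<Rightarrow> nat \<Rightarrow> real" where
  "score c i = (last (queries c) \<bullet> fst (cache c ! i)) / sqrt (real CARD('d))"

definition scores :: "('d::finite, 'v::finite) config \<Rightarrow> real list" where
  "scores c = map (score c) [0..<length (cache c)]"

definition weight :: "('d::finite, 'v::finite) config \<Rightarrow> nat \<Rightarrow> real" where
  "weight c i = exp (score c i)"

definition full_output :: "('d::finite, 'v::finite) config \<Rightarrow> real ^ 'v" where
  "full_output c =
     (\<Sum>i\<in>tokens c. weight c i *\<^sub>R snd (cache c ! i)) /\<^sub>R (\<Sum>i\<in>tokens c. weight c i)"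

definition true_error :: "('d::finite, 'v::finite) config \<Rightarrow> real ^ 'v \<Rightarrow> real" where
  "true_error c y = norm (y - full_output c)"

text \<open>
  An eviction mechanism, possibly randomized, yields the law of the retained set. It may a priori
  look at the whole configuration, values included.
\<close>

type_synonym ('d, 'v) mechanism = "('d, 'v) config \<Rightarrow> nat set pmf"

definition eviction_mechanism ::
  "('d::finite, 'v::finite) config set \<Rightarrow> ('d, 'v) mechanism \<Rightarrow> bool" where
  "eviction_mechanism C mech \<longleftrightarrow> (\<forall>c\<in>C. \<forall>S\<in>set_pmf (mech c). S \<subseteq> tokens c)"

definition deterministic_value_blind ::
  "('d::finite, 'v::finite) config set \<Rightarrow> ('d, 'v) mechanism \<Rightarrow> bool" where
  "deterministic_value_blind C mech \<longleftrightarrow>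
     (\<exists>g. \<forall>c\<in>C. mech c = return_pmf (g (keys c) (scores c) (queries c)))"

definition evicts_some_token ::
  "('d::finite, 'v::finite) config set \<Rightarrow> ('d, 'v) mechanism \<Rightarrow> bool" where
  "evicts_some_token C mech \<longleftrightarrow> (\<exists>c\<in>C. \<exists>S\<in>set_pmf (mech c). S \<noteq> tokens c)"

text \<open>
  The design is recorded as the whole sampling distribution of the retained set, which determines
  all inclusion probabilities. Keys and values of evicted tokens are not recorded.
\<close>

record ('d, 'v) info =
  retained_pairs :: "nat \<Rightarrow> ((real ^ 'd) \<times> (real ^ 'v)) option"
  design :: "nat set pmf"
  query_history :: "(real ^ 'd) list"

definition online_info ::
  "('d::finite, 'v::finite) mechanism \<Rightarrow> ('d, 'v) config \<Rightarrow> nat set \<Rightarrow> ('d, 'v) info" where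
  "online_info mech c S =
     \<lparr> retained_pairs = (\<lambda>i. if i \<in> S then Some (cache c ! i) else None),
       design = mech c,
       query_history = queries c \<rparr>"

text \<open>
  A quantity depending on the configuration and the realized retained set is measurable with
  respect to the online information iff it is computed from it by some (arbitrary) function.
\<close>

definition info_measurable ::
  "('d::finite, 'v::finite) config set \<Rightarrow> ('d, 'v) mechanism
     \<Rightarrow> (('d, 'v) config \<Rightarrow> nat set \<Rightarrow> 'b) \<Rightarrow> bool" where
  "info_measurable C mech X \<longleftrightarrow>
     (\<exists>f. \<forall>c\<in>C. \<forall>S\<in>set_pmf (mech c). X c S = f (online_info mech c S))"

text \<open>
  Consistency is along a sequence of problems indexed by \<open>m\<close> (growing cache length, retention
  budget, decode step, ...): convergence in probability of the estimation error to 0, uniformly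
  over the configurations \<open>C m\<close> of stage \<open>m\<close>.
\<close>

definition uniformly_consistent ::
  "(nat \<Rightarrow> ('d::finite, 'v::finite) config set) \<Rightarrow> (nat \<Rightarrow> ('d, 'v) mechanism)
     \<Rightarrow> (nat \<Rightarrow> ('d, 'v) config \<Rightarrow> nat set \<Rightarrow> real ^ 'v)
     \<Rightarrow> (nat \<Rightarrow> ('d, 'v) config \<Rightarrow> nat set \<Rightarrow> real) \<Rightarrow> bool" where
  "uniformly_consistent C mech yhat Ehat \<longleftrightarrow>
     (\<forall>\<epsilon>>0. \<forall>\<delta>>0. \<forall>\<^sub>F m in sequentially. \<forall>c\<in>C m.
        measure_pmf.prob (mech m c)
          {S. \<epsilon> < \<bar>Ehat m c S - true_error c (yhat m c S)\<bar>} < \<delta>)"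

end

theory Submission
  imports Defs
begin

text \<open>
  Shifting the value of one evicted token changes neither the keys, scores and queries nor,
  therefore, the retained set, the online information and \<open>yhat\<close>. Since all softmax weights are
  positive, the full output can be moved by an arbitrary vector in this way, so the true error is
  unbounded along configurations with identical online information. An estimator takes a single
  value on such a pair, and cannot be close to both true errors.
\<close>

text \<open>For \<open>j\<close> beyond the end of the cache the list update does nothing, so the
  invariance lemmas for keys, scores and weights hold for every \<open>j\<close>.\<close>

definition shift_value ::
  "nat \<Rightarrow> real ^ 'v \<Rightarrow> ('d::finite, 'v::finite) config \<Rightarrow> ('d, 'v) config" where
  "shift_value j u c =
     c\<lparr>cache := (cache c)[j := (fst (cache c ! j), snd (cache c ! j) + u)]\<rparr>"

lemma queries_shift_value [simp]: "queries (shift_value j u c) = queries c"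
  by (simp add: shift_value_def)

lemma length_cache_shift_value [simp]: "length (cache (shift_value j u c)) = length (cache c)"
  by (simp add: shift_value_def)

lemma tokens_shift_value [simp]: "tokens (shift_value j u c) = tokens c"
  by (simp add: tokens_def)

lemma configs_shift_value [simp]: "shift_value j u c \<in> configs t n \<longleftrightarrow> c \<in> configs t n"
  by (simp add: configs_def)

lemma cache_shift_value_other: "i \<noteq> j \<Longrightarrow> cache (shift_value j u c) ! i = cache c ! i"
  by (simp add: shift_value_def)

lemma fst_cache_shift_value [simp]: "fst (cache (shift_value j u c) ! i) = fst (cache c ! i)"
  by (cases "i = j"; cases "j < length (cache c)") (auto simp: shift_value_def list_update_beyond)

lemma snd_cache_shift_value:
  assumes "j \<in> tokens c"
  shows "snd (cache (shift_value j u c) ! i) = snd (cache c ! i) + (if i = j then u else 0)"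
  using assms by (auto simp: shift_value_def tokens_def)

lemma score_shift_value [simp]: "score (shift_value j u c) = score c"
  by (simp add: score_def fun_eq_iff)

lemma weight_shift_value [simp]: "weight (shift_value j u c) = weight c"
  by (simp add: weight_def fun_eq_iff)

lemma keys_shift_value [simp]: "keys (shift_value j u c) = keys c"
  by (rule nth_equalityI) (simp_all add: keys_def)

lemma scores_shift_value [simp]: "scores (shift_value j u c) = scores c"
  by (simp add: scores_def)

text \<open>Only the pair at \<open>j\<close> changes, and it is not retained. The design is part of
  the online information, so its agreement is a premise here; value-blindness supplies it
  later.\<close>

lemma online_info_shift_value:
  assumes "j \<notin> S" and "mech (shift_value j u c) = mech c"
  shows "online_info mech (shift_value j u c) S = online_info mech c S"
proof -
  have "cache (shift_value j u c) ! i = cache c ! i" if "i \<in> S" for i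
    using assms(1) that by (intro cache_shift_value_other) auto
  then show ?thesis
    using assms(2) by (simp add: online_info_def fun_eq_iff)
qed

lemma sum_weight_pos:
  assumes "j \<in> tokens c"
  shows "0 < (\<Sum>i\<in>tokens c. weight c i)"
  using assms by (intro sum_pos) (auto simp: tokens_def weight_def)

text \<open>The weights depend on keys and query only, so the output is linear in the values; the
  coefficient of \<open>u\<close> is the softmax weight of \<open>j\<close>.\<close>

lemma full_output_shift_value:
  assumes j: "j \<in> tokens c"
  shows "full_output (shift_value j u c) =
           full_output c + (weight c j / (\<Sum>i\<in>tokens c. weight c i)) *\<^sub>R u"
proof -
  have "finite (tokens c)"
    by (simp add: tokens_def)
  then have "(\<Sum>i\<in>tokens c. weight c i *\<^sub>R snd (cache (shift_value j u c) ! i)) =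
        (\<Sum>i\<in>tokens c. weight c i *\<^sub>R snd (cache c ! i)) + weight c j *\<^sub>R u"
    using j by (simp add: snd_cache_shift_value scaleR_add_right sum.distrib
      if_distrib[where f = "scaleR a" for a] cong: if_cong)
  then show ?thesis
    by (simp add: full_output_def scaleR_add_right divide_inverse mult.commute)
qed

text \<open>The softmax weight of \<open>j\<close> is positive, so scaling \<open>x\<close> by its
  inverse gives the required shift.\<close>

lemma ex_shift_value_full_output:
  assumes "j \<in> tokens c"
  obtains u where "full_output (shift_value j u c) = full_output c + x"
proof
  show "full_output
          (shift_value j (((\<Sum>i\<in>tokens c. weight c i) / weight c j) *\<^sub>R x) c) =
        full_output c + x"
    using sum_weight_pos[OF assms]
    by (simp add: full_output_shift_value[OF assms]) (simp add: weight_def)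
qed

lemma ex_shift_value_true_error:
  fixes c :: "('d::finite, 'v::finite) config"
  assumes "j \<in> tokens c"
  obtains u where "M < \<bar>true_error c y - true_error (shift_value j u c) y\<bar>"
proof -
  \<comment> \<open>Moving the full output by a vector of norm \<open>r\<close> makes the new error
    at least \<open>r - true_error c y\<close>, so the errors differ by at least
    \<open>r - 2 * true_error c y = \<bar>M\<bar> + 1\<close>.\<close>
  define r where "r = \<bar>M\<bar> + 1 + 2 * true_error c y"
  have r: "0 \<le> r"
    by (simp add: r_def true_error_def)
  obtain x :: "real ^ 'v" where x: "norm x = r"
    using vector_choose_size[OF r] by blast
  obtain u where u: "full_output (shift_value j u c) = full_output c + x"
    using ex_shift_value_full_output[OF assms] .
  have "norm x - norm (y - full_output c) \<le> norm (y - full_output c - x)"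
    using norm_triangle_ineq2[of x "y - full_output c"] by (simp add: norm_minus_commute)
  then have "M < \<bar>true_error c y - true_error (shift_value j u c) y\<bar>"
    using x by (simp add: true_error_def u r_def diff_diff_eq)
  then show thesis
    using that by blast
qed

text \<open>Both halves of the theorem rest on this pair. The laws are given as point masses at a
  common \<open>S\<close>, so that probabilities under them are 0 or 1.\<close>

lemma unidentifiable:
  assumes C: "C = configs t n"
    and evicting: "eviction_mechanism C mech" "evicts_some_token C mech"
    and blind: "deterministic_value_blind C mech"
    and yhat: "info_measurable C mech yhat"
  obtains c c' S where "c \<in> C" "c' \<in> C"
    and "mech c = return_pmf S" "mech c' = return_pmf S"
    and "online_info mech c S = online_info mech c' S"
    and "M < \<bar>true_error c (yhat c S) - true_error c' (yhat c' S)\<bar>"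
proof -
  obtain g where g: "\<And>c. c \<in> C \<Longrightarrow> mech c = return_pmf (g (keys c) (scores c) (queries c))"
    using blind unfolding deterministic_value_blind_def by blast
  obtain c S where c: "c \<in> C" "S \<in> set_pmf (mech c)" "S \<noteq> tokens c"
    using evicting(2) unfolding evicts_some_token_def by blast
  moreover have "S \<subseteq> tokens c"
    using evicting(1) c unfolding eviction_mechanism_def by blast
  ultimately obtain j where j: "j \<in> tokens c" "j \<notin> S"
    by blast
  obtain u where u: "M < \<bar>true_error c (yhat c S) - true_error (shift_value j u c) (yhat c S)\<bar>"
    using ex_shift_value_true_error[OF j(1)] .
  let ?c' = "shift_value j u c"
  have c': "?c' \<in> C"
    using c(1) C by simp
  \<comment> \<open>\<open>S\<close> lies in the support of a point mass, hence is the value of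
    \<open>g\<close>; the shift preserves all arguments of \<open>g\<close>.\<close>
  have mech: "mech c = return_pmf S" "mech ?c' = return_pmf S"
    using g[OF c(1)] g[OF c'] c(2) by simp_all
  have info: "online_info mech c S = online_info mech ?c' S"
    using online_info_shift_value[OF j(2), of mech u c] mech by simp
  \<comment> \<open>The system's output is itself computed from the online information, so one
    vector is compared with two distant full outputs.\<close>
  have "yhat ?c' S = yhat c S"
    using yhat c(1) c' mech info unfolding info_measurable_def by force
  with u c(1) c' mech info show thesis
    by (intro that[of c ?c' S]) simp_all
qed

theorem theorem1:
  fixes t n :: "nat \<Rightarrow> nat"
    and C :: "nat \<Rightarrow> ('d::finite, 'v::finite) config set"
    and mech :: "nat \<Rightarrow> ('d, 'v) mechanism"
    and yhat :: "nat \<Rightarrow> ('d, 'v) config \<Rightarrow> nat set \<Rightarrow> real ^ 'v"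
  assumes "\<And>m. C m = configs (t m) (n m)"
    and "\<And>m. eviction_mechanism (C m) (mech m)"
    and "\<And>m. evicts_some_token (C m) (mech m)"
    and "\<And>m. deterministic_value_blind (C m) (mech m)"
    and "\<And>m. info_measurable (C m) (mech m) (yhat m)"
  shows "(\<forall>m. \<forall>Ehat :: ('d, 'v) config \<Rightarrow> nat set \<Rightarrow> real.
            info_measurable (C m) (mech m) Ehat \<longrightarrow>
            (\<forall>M>0. \<exists>c\<in>C m. \<exists>c'\<in>C m.
               \<exists>S\<in>set_pmf (mech m c). \<exists>S'\<in>set_pmf (mech m c').
                 online_info (mech m) c S = online_info (mech m) c' S' \<and>
                 M < \<bar>true_error c (yhat m c S) - true_error c' (yhat m c' S')\<bar>))
       \<and> (\<forall>Ehat :: nat \<Rightarrow> ('d, 'v) config \<Rightarrow> nat set \<Rightarrow> real.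
            (\<forall>m. info_measurable (C m) (mech m) (Ehat m)) \<longrightarrow>
            \<not> uniformly_consistent C mech yhat Ehat)"
proof (intro conjI allI impI)
  fix m and Ehat :: "('d, 'v) config \<Rightarrow> nat set \<Rightarrow> real" and M :: real
  obtain c c' S where "c \<in> C m" "c' \<in> C m"
    and "mech m c = return_pmf S" "mech m c' = return_pmf S"
    and "online_info (mech m) c S = online_info (mech m) c' S"
    and "M < \<bar>true_error c (yhat m c S) - true_error c' (yhat m c' S)\<bar>"
    using unidentifiable[OF assms] .
  then show "\<exists>c\<in>C m. \<exists>c'\<in>C m. \<exists>S\<in>set_pmf (mech m c). \<exists>S'\<in>set_pmf (mech m c').
      online_info (mech m) c S = online_info (mech m) c' S' \<and>
      M < \<bar>true_error c (yhat m c S) - true_error c' (yhat m c' S')\<bar>"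
    by force
next
  fix Ehat :: "nat \<Rightarrow> ('d, 'v) config \<Rightarrow> nat set \<Rightarrow> real"
  assume Ehat: "\<forall>m. info_measurable (C m) (mech m) (Ehat m)"
  show "\<not> uniformly_consistent C mech yhat Ehat"
  proof
    assume "uniformly_consistent C mech yhat Ehat"
    \<comment> \<open>Tolerance and probability bound are both taken to be 1; a single late stage
      will give the contradiction.\<close>
    then have "\<forall>\<^sub>F m in sequentially. \<forall>c\<in>C m. measure_pmf.prob (mech m c)
        {S. 1 < \<bar>Ehat m c S - true_error c (yhat m c S)\<bar>} < 1"
      unfolding uniformly_consistent_def using zero_less_one by blast
    then obtain m where m: "\<And>c. c \<in> C m \<Longrightarrow> measure_pmf.prob (mech m c)
        {S. 1 < \<bar>Ehat m c S - true_error c (yhat m c S)\<bar>} < 1"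
      by (auto simp: eventually_sequentially)
    \<comment> \<open>Under a point mass at \<open>S\<close>, an event of probability below 1 cannot
      contain \<open>S\<close>.\<close>
    have close: "\<bar>Ehat m c S - true_error c (yhat m c S)\<bar> \<le> 1"
      if "c \<in> C m" "mech m c = return_pmf S" for c S
      using m[OF that(1)] that(2) by (simp add: indicator_def split: if_splits)
    obtain c c' S where c: "c \<in> C m" "c' \<in> C m"
        "mech m c = return_pmf S" "mech m c' = return_pmf S"
      and info: "online_info (mech m) c S = online_info (mech m) c' S"
      \<comment> \<open>Two errors within 1 of the same estimate differ by at most 2.\<close>
      and far: "2 < \<bar>true_error c (yhat m c S) - true_error c' (yhat m c' S)\<bar>"
      using unidentifiable[OF assms] .
    have "Ehat m c S = Ehat m c' S"
      using Ehat[rule_format, of m] c info unfolding info_measurable_def by force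
    then show False
      using close[OF c(1,3)] close[OF c(2,4)] far by linarith
  qed
qed

end
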